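(* Let $(M^2,T,d)$ be a closed two-dimensional piecewise flat metrized manifold and let $f(t)$ be a conformal variation of it, with $K_i(t)$ denoting the curvature at vertex $i$ of $(M,T,\mathcal{C}[f(t)])$ for an extension $\mathcal{C}$ of the variation. Then at $t=0$, for every vertex $i$, $$\frac{dK_i}{dt}=-\sum_{j}\frac{\ell_{ij}^*}{\ell_{ij}}\left(\frac{df_j}{dt}-\frac{df_i}{dt}\right),$$ where the sum is over all $j$ such that $\{i,j\}$ is an edge of $T$.
   Context: A triangulated manifold $(M,T)$ is a topological manifold with a triangulation $T$ (here finite, and simplices are determined by their vertices and written $\{i,j,\dots,k\}$). $V(T)$, $E(T)$, $E_+(T)$ are the sets of vertices, edges, and directed edges (each edge $\{i,j\}$ gives two directed edges $(i,j)$ and $(j,i)$); $X^*$ is the vector space of functions $X\to\mathbb{R}$. $(M,T,\ell)$, with $\ell\in E(T)^*$, is piecewise flat if every simplex can be realized as a nondegenerate Euclidean simplex with edge lengths given by $\ell$. A (piecewise flat) metric is $d\in E_+(T)^*$ such that with $\ell_{ij}=d_{ij}+d_{ji}$, $(M,T,\ell)$ is piecewise flat, and for every triangle $\{i,j,k\}$: $d_{ij}^2+d_{jk}^2+d_{ki}^2=d_{ji}^2+d_{ik}^2+d_{kj}^2$. (The $d_{ij}$ may be negative.) Then $(M,T,d)$ is a piecewise flat metrized manifold; $\mathfrak{met}(M,T)$ is the set of all metrics $d$. A conformal structure on an open set $U\subset V(T)^*$ is a smooth map $\mathcal{C}:U\to\mathfrak{met}(M,T)\subset E_+(T)^*$ such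 that, writing $d=\mathcal{C}[f]$ and $\ell_{ij}=d_{ij}+d_{ji}$, for each $(i,j)\in E_+(T)$ and $k\in V(T)$: $\partial\ell_{ij}/\partial f_i=d_{ij}$, and $\partial d_{ij}/\partial f_k=0$ if $k\ne i$ and $k\neq j$. A conformal variation of $(M,T,d)$ is a smooth curve $f:(-\varepsilon,\varepsilon)\to V(T)^*$ for which there is a conformal structure $\mathcal{C}:U\to\mathfrak{met}(M,T)$ with $f((-\varepsilon,\varepsilon))\subset U$ and $\mathcal{C}[f(0)]=d$; such $\mathcal{C}$ is called an extension of the variation. $\gamma_{i,jk}$ is the angle at vertex $i$ in the Euclidean triangle $\{i,j,k\}$ with edge lengths $\ell$. The curvature at $i$ is $K_i=2\pi-\sum\gamma_{i,jk}$, the sum being over all triangles $\{i,j,k\}$ containing $i$. For a triangle $\{i,j,k\}$ set $h_{ij,k}=\dfrac{d_{ik}-d_{ij}\cos\gamma_{i,jk}}{\sin\gamma_{i,jk}}$ (symmetric in $i,j$). The dual length of an edge $\{i,j\}$ contained in the two triangles $\{i,j,k\}$ and $\{i,j,\ell\}$ is $\ell_{ij}^*=h_{ij,k}+h_{ij,\ell}$. *)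

theory Defs
  imports "HOL-Analysis.Analysis"
begin

section \<open>Smooth maps\<close>

fun Ck_on :: "nat \<Rightarrow> 'a::real_normed_vector set \<Rightarrow> ('a \<Rightarrow> 'b::real_normed_vector) \<Rightarrow> bool" where
  "Ck_on 0 U f \<longleftrightarrow> continuous_on U f"
| "Ck_on (Suc n) U f \<longleftrightarrow>
     (\<forall>x\<in>U. f differentiable (at x)) \<and> (\<forall>v. Ck_on n U (\<lambda>x. frechet_derivative f (at x) v))"

text \<open>Only meant for open sets \<^term>\<open>U\<close>: the derivatives are unrestricted ones.\<close>

definition smooth_on :: "'a::real_normed_vector set \<Rightarrow> ('a \<Rightarrow> 'b::real_normed_vector) \<Rightarrow> bool" where
  "smooth_on U f \<longleftrightarrow> (\<forall>n. Ck_on n U f)"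

text \<open>The partial derivative of \<^term>\<open>g\<close> in the \<^term>\<open>k\<close>-th coordinate exists at
  \<^term>\<open>x\<close> and equals \<^term>\<open>D\<close>.\<close>

definition has_partial_derivative :: "(real^'v \<Rightarrow> real) \<Rightarrow> 'v::finite \<Rightarrow> real^'v \<Rightarrow> real \<Rightarrow> bool" where
  "has_partial_derivative g k x D \<longleftrightarrow>
     ((\<lambda>s. g (x + s *\<^sub>R axis k 1)) has_real_derivative D) (at 0)"


section \<open>Triangulated closed surfaces\<close>

definition locally_euclidean2 :: "'m topology \<Rightarrow> bool" where
  "locally_euclidean2 M \<longleftrightarrow>
     (\<forall>x\<in>topspace M. \<exists>W. openin M W \<and> x \<in> W \<and>
        (\<exists>B::(real^2) set. open B \<and> subtopology M W homeomorphic_space top_of_set B))"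

text \<open>Closed means compact and without boundary.\<close>

definition closed_surface :: "'m topology \<Rightarrow> bool" where
  "closed_surface M \<longleftrightarrow>
     Hausdorff_space M \<and> second_countable M \<and> locally_euclidean2 M \<and> compact_space M"

text \<open>A finite simplicial complex is given by the vertex sets of its simplices. Its set of vertices
  is the whole finite type \<^typ>\<open>'v\<close>, so that functions on the vertices are the elements
  of \<^typ>\<open>real^'v\<close>.\<close>

definition abstract_complex :: "'v::finite set set \<Rightarrow> bool" where
  "abstract_complex T \<longleftrightarrow>
     {} \<notin> T \<and> (\<forall>v. {v} \<in> T) \<and> (\<forall>\<sigma>\<in>T. \<forall>\<tau>. \<tau> \<subseteq> \<sigma> \<and> \<tau> \<noteq> {} \<longrightarrow> \<tau> \<in> T)"

definition geometric_realization :: "'v::finite set set \<Rightarrow> (real^'v) set" where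
  "geometric_realization T = (\<Union>\<sigma>\<in>T. convex hull ((\<lambda>v. axis v 1) ` \<sigma>))"

definition triangulates :: "'v::finite set set \<Rightarrow> 'm topology \<Rightarrow> bool" where
  "triangulates T M \<longleftrightarrow>
     abstract_complex T \<and> top_of_set (geometric_realization T) homeomorphic_space M"

definition directed_edges :: "'v set set \<Rightarrow> ('v \<times> 'v) set" where
  "directed_edges T = {(i, j). {i, j} \<in> T \<and> i \<noteq> j}"

definition triangles :: "'v set set \<Rightarrow> 'v set set" where
  "triangles T = {\<sigma>\<in>T. card \<sigma> = 3}"


section \<open>Piecewise flat metrics\<close>

text \<open>Functions on (directed) edges are curried; only their values on \<^term>\<open>directed_edges T\<close>
  carry meaning. The simplices of a triangulated surface have at most three vertices, so the
  plane suffices to realize them.\<close>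

definition realizes :: "('v \<Rightarrow> 'v \<Rightarrow> real) \<Rightarrow> 'v set \<Rightarrow> ('v \<Rightarrow> real^2) \<Rightarrow> bool" where
  "realizes l \<sigma> p \<longleftrightarrow>
     inj_on p \<sigma> \<and> \<not> affine_dependent (p ` \<sigma>) \<and>
     (\<forall>i\<in>\<sigma>. \<forall>j\<in>\<sigma>. i \<noteq> j \<longrightarrow> dist (p i) (p j) = l i j)"

definition piecewise_flat :: "'v set set \<Rightarrow> ('v \<Rightarrow> 'v \<Rightarrow> real) \<Rightarrow> bool" where
  "piecewise_flat T l \<longleftrightarrow> (\<forall>\<sigma>\<in>T. \<exists>p. realizes l \<sigma> p)"

definition edge_length :: "('v \<Rightarrow> 'v \<Rightarrow> real) \<Rightarrow> 'v \<Rightarrow> 'v \<Rightarrow> real" where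
  "edge_length d i j = d i j + d j i"

definition pf_metric :: "'v set set \<Rightarrow> ('v \<Rightarrow> 'v \<Rightarrow> real) \<Rightarrow> bool" where
  "pf_metric T d \<longleftrightarrow>
     piecewise_flat T (edge_length d) \<and>
     (\<forall>i j k. {i, j, k} \<in> triangles T \<longrightarrow>
        (d i j)\<^sup>2 + (d j k)\<^sup>2 + (d k i)\<^sup>2 = (d j i)\<^sup>2 + (d i k)\<^sup>2 + (d k j)\<^sup>2)"


section \<open>Angles, curvature and dual lengths\<close>

definition vector_angle :: "real^2 \<Rightarrow> real^2 \<Rightarrow> real" where
  "vector_angle u v = arccos (u \<bullet> v / (norm u * norm v))"

text \<open>\<^term>\<open>angle l i j k\<close> is the angle at \<^term>\<open>i\<close> of the Euclidean triangle with vertices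
  \<^term>\<open>i\<close>, \<^term>\<open>j\<close>, \<^term>\<open>k\<close> and edge lengths \<^term>\<open>l\<close>; by the law of cosines it does not
  depend on the realization.\<close>

definition angle :: "('v \<Rightarrow> 'v \<Rightarrow> real) \<Rightarrow> 'v \<Rightarrow> 'v \<Rightarrow> 'v \<Rightarrow> real" where
  "angle l i j k =
     (THE \<theta>. \<exists>p. realizes l {i, j, k} p \<and> \<theta> = vector_angle (p j - p i) (p k - p i))"

text \<open>The angle of a triangle at one of its vertices, without naming the other two vertices.\<close>

definition angle_in :: "('v \<Rightarrow> 'v \<Rightarrow> real) \<Rightarrow> 'v \<Rightarrow> 'v set \<Rightarrow> real" where
  "angle_in l i \<sigma> = (THE \<theta>. \<exists>j k. \<sigma> = {i, j, k} \<and> \<theta> = angle l i j k)"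

definition curvature :: "'v set set \<Rightarrow> ('v \<Rightarrow> 'v \<Rightarrow> real) \<Rightarrow> 'v \<Rightarrow> real" where
  "curvature T d i = 2 * pi - (\<Sum>\<sigma> | \<sigma> \<in> triangles T \<and> i \<in> \<sigma>. angle_in (edge_length d) i \<sigma>)"

definition height :: "('v \<Rightarrow> 'v \<Rightarrow> real) \<Rightarrow> 'v \<Rightarrow> 'v \<Rightarrow> 'v \<Rightarrow> real" where
  "height d i j k =
     (d i k - d i j * cos (angle (edge_length d) i j k)) / sin (angle (edge_length d) i j k)"

text \<open>On a closed surface the sum runs over the two vertices opposite to the edge.\<close>

definition dual_length :: "'v set set \<Rightarrow> ('v \<Rightarrow> 'v \<Rightarrow> real) \<Rightarrow> 'v \<Rightarrow> 'v \<Rightarrow> real" where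
  "dual_length T d i j = (\<Sum>k | {i, j, k} \<in> triangles T. height d i j k)"


section \<open>Conformal structures and variations\<close>

definition conformal_structure ::
  "'v::finite set set \<Rightarrow> (real^'v) set \<Rightarrow> (real^'v \<Rightarrow> 'v \<Rightarrow> 'v \<Rightarrow> real) \<Rightarrow> bool" where
  "conformal_structure T U C \<longleftrightarrow>
     open U \<and>
     (\<forall>x\<in>U. pf_metric T (C x)) \<and>
     (\<forall>(i, j)\<in>directed_edges T. smooth_on U (\<lambda>x. C x i j)) \<and>
     (\<forall>x\<in>U. \<forall>(i, j)\<in>directed_edges T.
        has_partial_derivative (\<lambda>y. edge_length (C y) i j) i x (C x i j) \<and>
        (\<forall>k. k \<noteq> i \<and> k \<noteq> j \<longrightarrow> has_partial_derivative (\<lambda>y. C y i j) k x 0))"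

definition conformal_extension ::
  "'v::finite set set \<Rightarrow> ('v \<Rightarrow> 'v \<Rightarrow> real) \<Rightarrow> real \<Rightarrow> (real \<Rightarrow> real^'v) \<Rightarrow>
     (real^'v) set \<Rightarrow> (real^'v \<Rightarrow> 'v \<Rightarrow> 'v \<Rightarrow> real) \<Rightarrow> bool" where
  "conformal_extension T d \<epsilon> f U C \<longleftrightarrow>
     conformal_structure T U C \<and> f ` {-\<epsilon><..<\<epsilon>} \<subseteq> U \<and>
     (\<forall>(i, j)\<in>directed_edges T. C (f 0) i j = d i j)"

definition conformal_variation ::
  "'v::finite set set \<Rightarrow> ('v \<Rightarrow> 'v \<Rightarrow> real) \<Rightarrow> real \<Rightarrow> (real \<Rightarrow> real^'v) \<Rightarrow> bool" where
  "conformal_variation T d \<epsilon> f \<longleftrightarrow>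
     \<epsilon> > 0 \<and> smooth_on {-\<epsilon><..<\<epsilon>} f \<and> (\<exists>U C. conformal_extension T d \<epsilon> f U C)"

end

theory Submission
  imports Defs
begin

text \<open>
  The formula is local: it holds triangle by triangle. In a triangle with vertices \<open>i\<close>, \<open>j\<close>, \<open>k\<close>
  the conformal conditions say that an edge length depends only on the conformal factors at its
  two ends, with \<open>\<ell>\<^sub>i\<^sub>j' = d\<^sub>i\<^sub>j f\<^sub>i' + d\<^sub>j\<^sub>i f\<^sub>j'\<close> along the variation
  (\<open>conformal_edge_length_derivative\<close>). Differentiating the law of cosines and eliminating \<open>d\<^sub>j\<^sub>k\<close>
  by the compatibility condition of a metric gives (\<open>conformal_angle_derivative\<close>)
  \<open>\<gamma>\<^sub>i' = (h\<^sub>i\<^sub>j / \<ell>\<^sub>i\<^sub>j) (f\<^sub>j' - f\<^sub>i') + (h\<^sub>i\<^sub>k / \<ell>\<^sub>i\<^sub>k) (f\<^sub>k' - f\<^sub>i')\<close>,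
  where \<open>h\<^sub>i\<^sub>j\<close> and \<open>h\<^sub>i\<^sub>k\<close> are the heights over the two sides at \<open>i\<close>. So each triangle at \<open>i\<close>
  contributes one term for each of its two edges at \<open>i\<close>, and collecting the terms edge by edge
  instead of triangle by triangle (\<open>sum_triangles_eq_sum_edges\<close>) adds up the heights over an edge
  to its dual length.
\<close>

section \<open>Angles from edge lengths\<close>

definition cosine_from_sides :: "real \<Rightarrow> real \<Rightarrow> real \<Rightarrow> real" where
  "cosine_from_sides a b e = (a\<^sup>2 + b\<^sup>2 - e\<^sup>2) / (2 * a * b)"

text \<open>Nondegeneracy is the strict Cauchy-Schwarz inequality for the two sides at \<open>i\<close>. It keeps the
  cosine inside the open interval on which \<^const>\<open>arccos\<close> is differentiable.\<close>

lemma realized_triangle: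
  assumes p: "realizes l {i, j, k} p" and ne: "i \<noteq> j" "i \<noteq> k" "j \<noteq> k"
  defines "c \<equiv> cosine_from_sides (l i j) (l i k) (l j k)"
  shows "l i j > 0" "l i k > 0" "\<bar>c\<bar> < 1"
    and "vector_angle (p j - p i) (p k - p i) = arccos c"
proof -
  define u v where "u = p j - p i" and "v = p k - p i"
  have d: "norm u = l i j" "norm v = l i k" "norm (u - v) = l j k"
    using p ne unfolding realizes_def u_def v_def
    by (auto simp: dist_norm norm_minus_commute)
  have pne: "p i \<noteq> p j" "p i \<noteq> p k" "p j \<noteq> p k"
    using p ne unfolding realizes_def inj_on_def by auto
  show pos: "l i j > 0" "l i k > 0"
    using pne d unfolding u_def v_def by (metis zero_less_norm_iff right_minus_eq)+
  have "2 * (u \<bullet> v) = (l i j)\<^sup>2 + (l i k)\<^sup>2 - (l j k)\<^sup>2"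
    unfolding d[symmetric] by (simp add: power2_norm_eq_inner inner_diff inner_commute)
  then have c: "c = u \<bullet> v / (norm u * norm v)"
    unfolding c_def cosine_from_sides_def d by (simp flip: \<open>2 * (u \<bullet> v) = _\<close>)
  then show "vector_angle (p j - p i) (p k - p i) = arccos c"
    unfolding vector_angle_def u_def v_def by simp
  have "\<not> collinear {p j, p i, p k}"
    using p pne collinear_3_eq_affine_dependent[of "p j" "p i" "p k"]
    unfolding realizes_def by (auto simp: insert_commute)
  then have "\<not> collinear {0, u, v}"
    unfolding u_def v_def by (simp add: collinear_3[symmetric])
  then have "\<bar>u \<bullet> v\<bar> \<noteq> norm u * norm v"
    by (simp add: norm_cauchy_schwarz_equal)
  then have "\<bar>u \<bullet> v\<bar> < norm u * norm v"
    using Cauchy_Schwarz_ineq2[of u v] by linarith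
  then show "\<bar>c\<bar> < 1"
    unfolding c using pos d by (simp add: abs_mult)
qed

lemma angle_eq_arccos:
  assumes "realizes l {i, j, k} p" "i \<noteq> j" "i \<noteq> k" "j \<noteq> k"
  shows "angle l i j k = arccos (cosine_from_sides (l i j) (l i k) (l j k))"
  unfolding angle_def
proof (rule the_equality)
  show "\<exists>p. realizes l {i, j, k} p \<and>
      arccos (cosine_from_sides (l i j) (l i k) (l j k)) = vector_angle (p j - p i) (p k - p i)"
    using realized_triangle(4)[OF assms] assms(1) by auto
qed (use realized_triangle(4)[OF _ assms(2-4)] in auto)

lemma angle_commute: "angle l i j k = angle l i k j"
proof -
  have sym: "vector_angle u v = vector_angle v u" for u v
    unfolding vector_angle_def by (simp add: inner_commute mult.commute)
  show ?thesis
    unfolding angle_def insert_commute[of j k] by (subst sym) (rule refl)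
qed

lemma triple_eq_iff:
  assumes "i \<noteq> j" "i \<noteq> k" "j \<noteq> k"
  shows "{i, j', k'} = {i, j, k} \<longleftrightarrow> j' = j \<and> k' = k \<or> j' = k \<and> k' = j"
proof
  assume "{i, j', k'} = {i, j, k}"
  then have "j \<in> {i, j', k'}" "k \<in> {i, j', k'}" by auto
  then show "j' = j \<and> k' = k \<or> j' = k \<and> k' = j" using assms by auto
qed auto

lemma angle_in_eq_angle:
  assumes "card {i, j, k} = 3"
  shows "angle_in l i {i, j, k} = angle l i j k"
  unfolding angle_in_def
proof (rule the_equality)
  fix \<theta> assume "\<exists>j' k'. {i, j, k} = {i, j', k'} \<and> \<theta> = angle l i j' k'"
  then obtain j' k' where e: "{i, j, k} = {i, j', k'}" and t: "\<theta> = angle l i j' k'" by blast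
  have "i \<noteq> j" "i \<noteq> k" "j \<noteq> k"
    using assms by (auto simp: card_insert_if split: if_splits)
  then have "j' = j \<and> k' = k \<or> j' = k \<and> k' = j"
    using e triple_eq_iff by metis
  then show "\<theta> = angle l i j k"
    using t angle_commute[of l i j k] by auto
qed auto


section \<open>Conformal variations\<close>

lemma has_partial_derivative_unique:
  assumes "(g has_derivative D) (at x)" "has_partial_derivative g k x c"
  shows "D (axis k 1) = c"
proof -
  have "((\<lambda>s. x + s *\<^sub>R axis k 1) has_derivative (\<lambda>s. s *\<^sub>R axis k 1)) (at (0::real))"
    by (auto intro!: derivative_eq_intros)
  then have "((\<lambda>s. g (x + s *\<^sub>R axis k 1)) has_derivative (\<lambda>s. D (s *\<^sub>R axis k 1))) (at 0)"
    using has_derivative_compose[of "\<lambda>s. x + s *\<^sub>R axis k 1" _ 0 UNIV g D] assms(1) by simp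
  moreover have "D (s *\<^sub>R axis k 1) = D (axis k 1) * s" for s
    using linear_scale[OF has_derivative_linear[OF assms(1)], of s "axis k 1"] by simp
  ultimately have "((\<lambda>s. g (x + s *\<^sub>R axis k 1)) has_real_derivative D (axis k 1)) (at 0)"
    unfolding has_field_derivative_def by simp
  then show ?thesis
    using assms(2) DERIV_unique unfolding has_partial_derivative_def by blast
qed

lemma smooth_on_imp_differentiable:
  assumes "smooth_on U g" "x \<in> U"
  shows "g differentiable (at x)"
proof -
  have "Ck_on (Suc 0) U g" using assms(1) unfolding smooth_on_def by blast
  then show ?thesis using assms(2) by simp
qed

lemma directed_edges_commute: "(j, i) \<in> directed_edges T \<longleftrightarrow> (i, j) \<in> directed_edges T"
  unfolding directed_edges_def by (auto simp: insert_commute)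

lemma simplex_edges:
  assumes "abstract_complex T" "\<sigma> \<in> T" "a \<in> \<sigma>" "b \<in> \<sigma>" "a \<noteq> b"
  shows "(a, b) \<in> directed_edges T"
  using assms unfolding abstract_complex_def directed_edges_def by auto

text \<open>By differentiability the rate is a combination of partial derivatives. The conformal conditions
  leave only those at the two ends of the edge, which are the two summands of the length itself.\<close>

lemma conformal_edge_length_derivative:
  fixes T :: "'v::finite set set"
  assumes conf: "conformal_structure T U C" and e: "(i, j) \<in> directed_edges T"
    and f: "(f has_vector_derivative v) (at t)" and ft: "f t \<in> U"
  shows "((\<lambda>s. edge_length (C (f s)) i j) has_real_derivative
           C (f t) i j * v $ i + C (f t) j i * v $ j) (at t)"
proof -
  let ?L = "\<lambda>y. edge_length (C y) i j"
  have ij: "i \<noteq> j" using e unfolding directed_edges_def by auto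
  have e': "(j, i) \<in> directed_edges T" using e by (simp add: directed_edges_commute)
  have "(\<lambda>y. C y i j) differentiable (at (f t))" "(\<lambda>y. C y j i) differentiable (at (f t))"
    using conf e e' ft smooth_on_imp_differentiable unfolding conformal_structure_def by blast+
  then have "?L differentiable (at (f t))"
    unfolding edge_length_def by (rule differentiable_add)
  then obtain D where D: "(?L has_derivative D) (at (f t))"
    unfolding differentiable_def by blast
  have pd: "has_partial_derivative (\<lambda>y. edge_length (C y) a b) a (f t) (C (f t) a b)"
    and pd0: "\<And>k. k \<noteq> a \<Longrightarrow> k \<noteq> b \<Longrightarrow> has_partial_derivative (\<lambda>y. C y a b) k (f t) 0"
    if "(a, b) \<in> directed_edges T" for a b
    using conf ft that unfolding conformal_structure_def by blast+
  have sym: "(\<lambda>y. edge_length (C y) j i) = ?L"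
    unfolding edge_length_def by (simp add: add.commute)
  have Di: "D (axis i 1) = C (f t) i j"
    by (rule has_partial_derivative_unique[OF D pd[OF e]])
  have Dj: "D (axis j 1) = C (f t) j i"
    by (rule has_partial_derivative_unique[OF D pd[OF e', unfolded sym]])
  have Dk: "D (axis k 1) = 0" if "k \<noteq> i" "k \<noteq> j" for k
  proof (rule has_partial_derivative_unique[OF D])
    show "has_partial_derivative ?L k (f t) 0"
      using DERIV_add[OF pd0[OF e that, unfolded has_partial_derivative_def]
          pd0[OF e' that(2,1), unfolded has_partial_derivative_def]]
      unfolding has_partial_derivative_def edge_length_def by simp
  qed
  have lin: "linear D" by (rule has_derivative_linear[OF D])
  have "D v = D (\<Sum>k\<in>UNIV. v $ k *\<^sub>R axis k 1)"
    by (simp add: basis_expansion[of v] scalar_mult_eq_scaleR[symmetric])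
  also have "\<dots> = (\<Sum>k\<in>UNIV. v $ k * D (axis k 1))"
    by (simp add: linear_sum[OF lin] linear_scale[OF lin])
  also have "\<dots> = (\<Sum>k\<in>{i, j}. v $ k * D (axis k 1))"
    by (rule sum.mono_neutral_right) (auto simp: Dk)
  also have "\<dots> = C (f t) i j * v $ i + C (f t) j i * v $ j"
    using ij by (simp add: Di Dj mult.commute)
  finally have Dv: "D v = C (f t) i j * v $ i + C (f t) j i * v $ j" .
  have "((\<lambda>s. ?L (f s)) has_derivative (\<lambda>s. D (s *\<^sub>R v))) (at t)"
    using has_derivative_compose[OF f[unfolded has_vector_derivative_def], of ?L D] D by simp
  then show ?thesis
    unfolding has_field_derivative_def Dv[symmetric]
    by (simp add: linear_scale[OF lin] mult_commute_abs)
qed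

lemma cosine_from_sides_derivative:
  assumes "(a has_real_derivative a') (at t)" "(b has_real_derivative b') (at t)"
    and "(e has_real_derivative e') (at t)" and nz: "a t \<noteq> 0" "b t \<noteq> 0"
  shows "((\<lambda>s. cosine_from_sides (a s) (b s) (e s)) has_real_derivative
    (a t * a' + b t * b' - e t * e' - (a' * b t + a t * b') * cosine_from_sides (a t) (b t) (e t))
      / (a t * b t)) (at t)"
proof -
  let ?N = "(a t)\<^sup>2 + (b t)\<^sup>2 - (e t)\<^sup>2" and ?D = "2 * a t * b t"
  have "((\<lambda>s. (a s)\<^sup>2 + (b s)\<^sup>2 - (e s)\<^sup>2) has_real_derivative
      2 * (a t * a' + b t * b' - e t * e')) (at t)"
    by (auto intro!: derivative_eq_intros assms(1-3))
  moreover have "((\<lambda>s. 2 * a s * b s) has_real_derivative 2 * (a' * b t + a t * b')) (at t)"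
    by (auto intro!: derivative_eq_intros assms(1-3))
  ultimately have "((\<lambda>s. cosine_from_sides (a s) (b s) (e s)) has_real_derivative
      (2 * (a t * a' + b t * b' - e t * e') * ?D - ?N * (2 * (a' * b t + a t * b'))) / (?D * ?D)) (at t)"
    unfolding cosine_from_sides_def by (rule DERIV_divide) (use nz in simp)
  also have "(2 * m * ?D - n * (2 * s)) / (?D * ?D) = (m - s * (n / ?D)) / (a t * b t)" for m n s
    using nz by (simp add: divide_simps)
  finally show ?thesis
    unfolding cosine_from_sides_def .
qed

text \<open>The algebraic core: \<open>a = p + p'\<close>, \<open>b = q + q'\<close> and \<open>e = r + r'\<close> are the sides \<open>ij\<close>, \<open>ik\<close>, \<open>jk\<close>
  of a triangle split as \<open>d\<^sub>i\<^sub>j + d\<^sub>j\<^sub>i\<close> etc., \<open>x\<close>, \<open>y\<close>, \<open>z\<close> are the rates of the conformal factors at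
  \<open>i\<close>, \<open>j\<close>, \<open>k\<close>, and \<open>c\<close> is the cosine of the angle at \<open>i\<close>. The law of cosines has been
  differentiated in the form \<open>2abc = a\<^sup>2 + b\<^sup>2 - e\<^sup>2\<close>. The quotients \<open>(q - pc)/a\<close> and
  \<open>(p - qc)/b\<close> are the heights over the two sides divided by the sides, up to the sine of the
  angle.\<close>

lemma law_of_cosines_variation:
  fixes a b e c c' p p' q q' r r' x y z :: real
  assumes sides: "a = p + p'" "b = q + q'" "e = r + r'" and nz: "a \<noteq> 0" "b \<noteq> 0"
    and compat: "p\<^sup>2 + r\<^sup>2 + q'\<^sup>2 = p'\<^sup>2 + q\<^sup>2 + r'\<^sup>2"
    and cosine: "2 * a * b * c = a\<^sup>2 + b\<^sup>2 - e\<^sup>2"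
    and variation: "a * b * c' = a * (p * x + p' * y) + b * (q * x + q' * z) - e * (r * y + r' * z)
           - ((p * x + p' * y) * b + a * (q * x + q' * z)) * c"
  shows "- c' = (q - p * c) / a * (y - x) + (p - q * c) / b * (z - x)"
proof -
  \<comment> \<open>Comparing the coefficients of \<open>y\<close> and of \<open>z\<close>; those of \<open>x\<close> agree identically. This is where
    the compatibility condition enters.\<close>
  have Y: "a * b * c = a * p' + b * q - e * r"
    using cosine compat unfolding sides power2_eq_square by (simp add: algebra_simps)
  have Z: "a * b * c = b * q' + a * p - e * r'"
    using cosine compat unfolding sides power2_eq_square by (simp add: algebra_simps)
  have "- (a * b * c') - (b * (q - p * c) * (y - x) + a * (p - q * c) * (z - x)) =
      (a * b * c - (a * p' + b * q - e * r)) * y + (a * b * c - (b * q' + a * p - e * r')) * z"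
    unfolding variation unfolding sides by (simp add: algebra_simps)
  then have "a * b * (- c') = b * (q - p * c) * (y - x) + a * (p - q * c) * (z - x)"
    using Y Z by simp
  then show ?thesis
    using nz by (simp add: field_simps)
qed

lemma conformal_angle_derivative:
  fixes T :: "'v::finite set set"
  assumes conf: "conformal_structure T U C" and T: "abstract_complex T"
    and tri: "{i, j, k} \<in> triangles T"
    and f: "(f has_vector_derivative v) (at t)" and ft: "f t \<in> U"
  defines "d \<equiv> C (f t)"
  shows "((\<lambda>s. angle (edge_length (C (f s))) i j k) has_real_derivative
           height d i j k / edge_length d i j * (v $ j - v $ i) +
           height d i k j / edge_length d i k * (v $ k - v $ i)) (at t)"
proof -
  have ijk: "{i, j, k} \<in> T" and "card {i, j, k} = 3"
    using tri unfolding triangles_def by auto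
  then have ne: "i \<noteq> j" "i \<noteq> k" "j \<noteq> k"
    by (auto simp: card_insert_if split: if_splits)
  have e: "(i, j) \<in> directed_edges T" "(i, k) \<in> directed_edges T" "(j, k) \<in> directed_edges T"
    using ne simplex_edges[OF T ijk] by auto
  let ?cos = "\<lambda>l. cosine_from_sides (l i j) (l i k) (l j k)"
  have pf: "pf_metric T (C x)" if "x \<in> U" for x
    using conf that unfolding conformal_structure_def by blast
  then have real: "\<exists>p. realizes (edge_length (C x)) {i, j, k} p" if "x \<in> U" for x
    using ijk that unfolding pf_metric_def piecewise_flat_def by blast
  have angle_C: "angle (edge_length (C x)) i j k = arccos (?cos (edge_length (C x)))"
    if "x \<in> U" for x
    using real[OF that] angle_eq_arccos ne by metis
  define a b e1 where "a = edge_length d i j" and "b = edge_length d i k" and "e1 = edge_length d j k"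
  define c where "c = cosine_from_sides a b e1"
  have pos: "a > 0" "b > 0" and c1: "\<bar>c\<bar> < 1"
    using real[OF ft] realized_triangle(1-3)[OF _ ne] unfolding a_def b_def c_def e1_def d_def
    by blast+
  define c' where "c' = (a * (d i j * v $ i + d j i * v $ j) + b * (d i k * v $ i + d k i * v $ k)
      - e1 * (d j k * v $ j + d k j * v $ k)
      - ((d i j * v $ i + d j i * v $ j) * b + a * (d i k * v $ i + d k i * v $ k)) * c) / (a * b)"
  note lengths = conformal_edge_length_derivative[OF conf _ f ft, folded d_def]
  have "((\<lambda>s. ?cos (edge_length (C (f s)))) has_real_derivative c') (at t)"
    using cosine_from_sides_derivative[OF lengths[OF e(1)] lengths[OF e(2)] lengths[OF e(3)]] pos
    unfolding c'_def c_def a_def b_def e1_def d_def by simp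
  moreover have ct: "?cos (edge_length (C (f t))) = c"
    unfolding c_def a_def b_def e1_def d_def ..
  ultimately have "((\<lambda>s. arccos (?cos (edge_length (C (f s))))) has_real_derivative
      inverse (- sqrt (1 - c\<^sup>2)) * c') (at t)"
    using DERIV_chain2[OF DERIV_arccos, of "\<lambda>s. ?cos (edge_length (C (f s)))" t c' UNIV] c1
    by (simp add: abs_less_iff)
  \<comment> \<open>The angle is given by the law of cosines only where the curve stays in \<open>U\<close>.\<close>
  moreover have ev: "\<forall>\<^sub>F s in nhds t.
      arccos (?cos (edge_length (C (f s)))) = angle (edge_length (C (f s))) i j k"
  proof -
    have "isCont f t" using f by (rule has_vector_derivative_continuous)
    moreover have "open U" using conf unfolding conformal_structure_def by blast
    ultimately have "\<forall>\<^sub>F s in at t. f s \<in> U"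
      using ft by (auto simp: continuous_at intro: topological_tendstoD)
    then have "\<forall>\<^sub>F s in nhds t. f s \<in> U"
      using ft by (simp add: eventually_nhds_conv_at)
    then show ?thesis by eventually_elim (simp add: angle_C)
  qed
  ultimately have deriv: "((\<lambda>s. angle (edge_length (C (f s))) i j k) has_real_derivative
      inverse (- sqrt (1 - c\<^sup>2)) * c') (at t)"
    using DERIV_cong_ev[OF refl ev refl] by blast
  have angle: "angle (edge_length d) i j k = arccos c"
    using angle_C[OF ft] ct unfolding d_def by simp
  have h: "height d i j k = (d i k - d i j * c) / sqrt (1 - c\<^sup>2)"
      "height d i k j = (d i j - d i k * c) / sqrt (1 - c\<^sup>2)"
    using c1 unfolding height_def angle_commute[of _ i k j] angle
    by (simp_all add: sin_arccos_abs cos_arccos_abs)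
  have "- c' = (d i k - d i j * c) / a * (v $ j - v $ i) + (d i j - d i k * c) / b * (v $ k - v $ i)"
  proof (rule law_of_cosines_variation[where p' = "d j i" and q' = "d k i" and r = "d j k"
        and r' = "d k j" and e = e1])
    show "(d i j)\<^sup>2 + (d j k)\<^sup>2 + (d k i)\<^sup>2 = (d j i)\<^sup>2 + (d i k)\<^sup>2 + (d k j)\<^sup>2"
      using pf[OF ft] tri unfolding pf_metric_def d_def by blast
    show "2 * a * b * c = a\<^sup>2 + b\<^sup>2 - e1\<^sup>2"
      using pos unfolding c_def cosine_from_sides_def by simp
  qed (use pos in \<open>simp_all add: a_def b_def e1_def edge_length_def c'_def\<close>)
  then have "inverse (- sqrt (1 - c\<^sup>2)) * c' =
      height d i j k / a * (v $ j - v $ i) + height d i k j / b * (v $ k - v $ i)"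
    unfolding h by (simp add: divide_simps)
  then show ?thesis
    using deriv unfolding a_def b_def by simp
qed


section \<open>From triangles to edges\<close>

lemma triangle_vertices:
  assumes "\<sigma> \<in> triangles T" "i \<in> \<sigma>"
  obtains j k where "\<sigma> = {i, j, k}" "i \<noteq> j" "i \<noteq> k" "j \<noteq> k"
proof -
  have "card \<sigma> = Suc (Suc (Suc 0))" using assms(1) unfolding triangles_def by simp
  then have "card (\<sigma> - {i}) = 2" using assms(2) by simp
  then obtain j k where "\<sigma> - {i} = {j, k}" "j \<noteq> k" by (auto simp: card_2_iff)
  then show thesis using assms(2) by (intro that[of j k]) auto
qed

text \<open>Both sides are the sum of \<open>g j k\<close> over all ordered pairs with \<open>{i, j, k}\<close> a triangle, grouped
  once by the triangle, where each fibre is a pair and its swap, and once by the edge \<open>{i, j}\<close>.\<close>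

lemma sum_triangles_eq_sum_edges:
  fixes T :: "'v::finite set set" and g :: "'v \<Rightarrow> 'v \<Rightarrow> real"
  assumes T: "abstract_complex T"
    and G: "\<And>j k. {i, j, k} \<in> triangles T \<Longrightarrow> G {i, j, k} = g j k + g k j"
  shows "(\<Sum>\<sigma> | \<sigma> \<in> triangles T \<and> i \<in> \<sigma>. G \<sigma>) =
    (\<Sum>j | (i, j) \<in> directed_edges T. \<Sum>k | {i, j, k} \<in> triangles T. g j k)"
proof -
  define P where "P = {(j, k). {i, j, k} \<in> triangles T}"
  let ?S = "{\<sigma>. \<sigma> \<in> triangles T \<and> i \<in> \<sigma>}" and ?E = "{j. (i, j) \<in> directed_edges T}"
  let ?g = "\<lambda>(j, k). g j k"
  have "sum G ?S = (\<Sum>\<sigma>\<in>?S. sum ?g {x \<in> P. (\<lambda>(j, k). {i, j, k}) x = \<sigma>})"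
  proof (rule sum.cong)
    fix \<sigma> assume "\<sigma> \<in> ?S"
    then obtain j k where s: "\<sigma> = {i, j, k}" and tri: "{i, j, k} \<in> triangles T"
      and ne: "i \<noteq> j" "i \<noteq> k" "j \<noteq> k"
      using triangle_vertices[of \<sigma> T i] by blast
    have "{x \<in> P. (\<lambda>(j, k). {i, j, k}) x = \<sigma>} = {(j, k), (k, j)}"
      unfolding P_def s using tri by (auto simp: triple_eq_iff[OF ne] insert_commute[of k j])
    then show "G \<sigma> = sum ?g {x \<in> P. (\<lambda>(j, k). {i, j, k}) x = \<sigma>}"
      using ne G[OF tri] s by simp
  qed simp
  also have "\<dots> = sum ?g P"
    by (rule sum.group) (auto simp: P_def)
  also have "\<dots> = (\<Sum>j\<in>?E. sum ?g {x \<in> P. fst x = j})"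
  proof (rule sum.group[symmetric])
    show "fst ` P \<subseteq> ?E"
    proof clarify
      fix j k assume "(j, k) \<in> P"
      then have "{i, j, k} \<in> T" and "card {i, j, k} = 3"
        unfolding P_def triangles_def by auto
      moreover from this have "i \<noteq> j"
        by (auto simp: card_insert_if split: if_splits)
      ultimately show "(i, fst (j, k)) \<in> directed_edges T"
        using simplex_edges[OF T, of "{i, j, k}" i j] by auto
    qed
  qed auto
  also have "\<dots> = (\<Sum>j\<in>?E. \<Sum>k | {i, j, k} \<in> triangles T. g j k)"
  proof (rule sum.cong)
    fix j
    have "{x \<in> P. fst x = j} = Pair j ` {k. {i, j, k} \<in> triangles T}"
      unfolding P_def by auto
    then show "sum ?g {x \<in> P. fst x = j} = (\<Sum>k | {i, j, k} \<in> triangles T. g j k)"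
      by (simp add: sum.reindex inj_on_def)
  qed simp
  finally show ?thesis .
qed

lemma conformal_curvature_derivative:
  fixes T :: "'v::finite set set"
  assumes conf: "conformal_structure T U C" and T: "abstract_complex T"
    and f: "(f has_vector_derivative v) (at t)" and ft: "f t \<in> U"
  defines "d \<equiv> C (f t)"
  shows "((\<lambda>s. curvature T (C (f s)) i) has_real_derivative
           - (\<Sum>j | (i, j) \<in> directed_edges T.
               dual_length T d i j / edge_length d i j * (v $ j - v $ i))) (at t)"
proof -
  define g where "g j k = height d i j k / edge_length d i j * (v $ j - v $ i)" for j k
  define \<Theta> where "\<Theta> s \<sigma> = angle_in (edge_length (C (f s))) i \<sigma>" for s \<sigma>
  have \<Theta>: "((\<lambda>s. \<Theta> s {i, j, k}) has_real_derivative g j k + g k j) (at t)"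
    if tri: "{i, j, k} \<in> triangles T" for j k
    using conformal_angle_derivative[OF conf T tri f ft] tri
    unfolding \<Theta>_def g_def d_def by (simp add: angle_in_eq_angle triangles_def)
  \<comment> \<open>A triangle does not tell its other two vertices apart, so its rate is named without them.\<close>
  define G where "G \<sigma> = deriv (\<lambda>s. \<Theta> s \<sigma>) t" for \<sigma>
  have G: "((\<lambda>s. \<Theta> s \<sigma>) has_real_derivative G \<sigma>) (at t)"
    if "\<sigma> \<in> {\<sigma>. \<sigma> \<in> triangles T \<and> i \<in> \<sigma>}" for \<sigma>
  proof -
    from that obtain j k where "\<sigma> = {i, j, k}" "{i, j, k} \<in> triangles T"
      using triangle_vertices[of \<sigma> T i] by blast
    then show ?thesis
      unfolding G_def using DERIV_imp_deriv[OF \<Theta>] \<Theta> by simp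
  qed
  have "((\<lambda>s. \<Sum>\<sigma> | \<sigma> \<in> triangles T \<and> i \<in> \<sigma>. \<Theta> s \<sigma>) has_real_derivative
      (\<Sum>\<sigma> | \<sigma> \<in> triangles T \<and> i \<in> \<sigma>. G \<sigma>)) (at t)"
    by (rule DERIV_sum) (rule G)
  then have "((\<lambda>s. curvature T (C (f s)) i) has_real_derivative
      - (\<Sum>\<sigma> | \<sigma> \<in> triangles T \<and> i \<in> \<sigma>. G \<sigma>)) (at t)"
    unfolding curvature_def \<Theta>_def[symmetric] using DERIV_diff[OF DERIV_const, of _ _ t UNIV "2 * pi"]
    by fastforce
  also have "(\<Sum>\<sigma> | \<sigma> \<in> triangles T \<and> i \<in> \<sigma>. G \<sigma>) =
      (\<Sum>j | (i, j) \<in> directed_edges T. \<Sum>k | {i, j, k} \<in> triangles T. g j k)"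
    by (rule sum_triangles_eq_sum_edges[OF T]) (auto simp: G_def intro: DERIV_imp_deriv \<Theta>)
  also have "\<dots> = (\<Sum>j | (i, j) \<in> directed_edges T.
      dual_length T d i j / edge_length d i j * (v $ j - v $ i))"
    unfolding g_def dual_length_def by (simp add: sum_distrib_right sum_divide_distrib)
  finally show ?thesis .
qed

text \<open>The metric that a variation starts from and an extension of it at time 0 are only related on
  the directed edges. This is enough for dual lengths, which are sums of heights.\<close>

lemma height_cong:
  assumes T: "abstract_complex T" and tri: "{i, j, k} \<in> triangles T"
    and eq: "\<forall>(a, b)\<in>directed_edges T. d a b = d' a b"
  shows "height d i j k = height d' i j k"
proof -
  have ijk: "{i, j, k} \<in> T" and card: "card {i, j, k} = 3"
    using tri unfolding triangles_def by auto
  have *: "d a b = d' a b" if "a \<in> {i, j, k}" "b \<in> {i, j, k}" "a \<noteq> b" for a b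
    using eq simplex_edges[OF T ijk that] by blast
  have "edge_length d a b = edge_length d' a b" if "a \<in> {i, j, k}" "b \<in> {i, j, k}" "a \<noteq> b" for a b
    unfolding edge_length_def using *[OF that] *[OF that(2,1) that(3)[symmetric]] by simp
  then have "realizes (edge_length d) {i, j, k} = realizes (edge_length d') {i, j, k}"
    unfolding realizes_def by (intro ext conj_cong ball_cong imp_cong refl) auto
  then have "angle (edge_length d) i j k = angle (edge_length d') i j k"
    unfolding angle_def by simp
  moreover have "i \<noteq> j" "i \<noteq> k"
    using card by (auto simp: card_insert_if split: if_splits)
  ultimately show ?thesis
    unfolding height_def using *[of i j] *[of i k] by simp
qed

theorem theorem32:
  fixes M :: "'m topology"
    and T :: "'v::finite set set"
    and d :: "'v \<Rightarrow> 'v \<Rightarrow> real"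
    and \<epsilon> :: real
    and f :: "real \<Rightarrow> real^'v"
    and U :: "(real^'v) set"
    and C :: "real^'v \<Rightarrow> 'v \<Rightarrow> 'v \<Rightarrow> real"
    and i :: 'v
  assumes "closed_surface M"
    and "triangulates T M"
    and "pf_metric T d"
    and "conformal_variation T d \<epsilon> f"
    and "conformal_extension T d \<epsilon> f U C"
  shows "((\<lambda>t. curvature T (C (f t)) i) has_real_derivative
           - (\<Sum>j | (i, j) \<in> directed_edges T.
               dual_length T d i j / edge_length d i j *
               (deriv (\<lambda>t. f t $ j) 0 - deriv (\<lambda>t. f t $ i) 0))) (at 0)"
proof -
  have T: "abstract_complex T" using assms(2) unfolding triangulates_def by blast
  have \<epsilon>: "0 \<in> {-\<epsilon><..<\<epsilon>}" and smooth: "smooth_on {-\<epsilon><..<\<epsilon>} f"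
    using assms(4) unfolding conformal_variation_def by auto
  have conf: "conformal_structure T U C" and ft: "f 0 \<in> U"
    and start: "\<forall>(a, b)\<in>directed_edges T. C (f 0) a b = d a b"
    using assms(5) \<epsilon> unfolding conformal_extension_def by auto
  obtain v where f: "(f has_vector_derivative v) (at 0)"
    using smooth_on_imp_differentiable[OF smooth \<epsilon>] by (auto simp: vector_derivative_works)
  have "((\<lambda>t. f t $ j) has_real_derivative v $ j) (at 0)" for j
    using bounded_linear.has_vector_derivative[OF bounded_linear_vec_nth f, of j]
    by (simp add: has_real_derivative_iff_has_vector_derivative)
  then have v: "deriv (\<lambda>t. f t $ j) 0 = v $ j" for j
    by (rule DERIV_imp_deriv)
  have "dual_length T (C (f 0)) i j = dual_length T d i j" for j
    unfolding dual_length_def using height_cong[OF T _ start] by (intro sum.cong) auto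
  moreover have "edge_length (C (f 0)) i j = edge_length d i j" if "(i, j) \<in> directed_edges T" for j
    using bspec[OF start that] bspec[OF start, of "(j, i)"] that
    unfolding edge_length_def by (simp add: directed_edges_commute)
  ultimately show ?thesis
    using conformal_curvature_derivative[OF conf T f ft, of i] unfolding v by simp
qed

end
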